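(* Let $\lambda\in\mathbb{R}$, let $k\ge 2$ be an integer, and let $f_1,\dots,f_k:\mathbb{N}\to\mathbb{R}$ be functions. Define a function $h:\mathbb{N}\to\mathbb{R}$ by the rule that, for every finite set $T$, $$h(\#T)=\sum_{(T_1,\dots,T_k)} \lambda^{\#T_1+\cdots+\#T_k-\#(T_1\cup\cdots\cup T_k)}\, f_1(\#T_1)\cdots f_k(\#T_k),$$ or by the rule $$h(\#T)=\sum_{(T_1,\dots,T_k)} \lambda^{\eta(T_1,\dots,T_k)}\, f_1(\#T_1)\cdots f_k(\#T_k),$$ where in both sums $(T_1,\dots,T_k)$ ranges over all ordered $k$-tuples of (possibly empty, not necessarily disjoint) subsets of $T$ such that $T_1\cup\cdots\cup T_k=T$, and $$\eta(T_1,\dots,T_k)=\sum_{I\subseteq\{1,\dots,k\},\ \#I\ge 2}(-1)^{\#I}\,\#\Big(\bigcap_{i\in I}T_i\Big).$$ Then, with either definition of $h$, $$E_{\lambda,h}=\prod_{i=1}^k E_{\lambda,f_i}\quad\text{in } \widehat{\mathrm{Sh}}_\lambda(\mathbb{R}).$$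
   Context: $\mathbb{N}=\{0,1,2,\dots\}$; $\#Y$ is the cardinality of a finite set $Y$; $\lambda^0=1$ (also for $\lambda=0$). For $\lambda\in\mathbb{R}$, $\widehat{\mathrm{Sh}}_\lambda(\mathbb{R})=\prod_{k\ge 0}\mathbb{R}\,\mathbf{1}_k$ is the commutative $\mathbb{R}$-algebra of all formal infinite sums $\sum_{k\ge 0}a_k\mathbf{1}_k$ with $a_k\in\mathbb{R}$ (here $\mathbf{1}_k$ stands for $1\otimes\cdots\otimes 1$ with $k+1$ factors; this is the complete free commutative Rota–Baxter algebra of weight $\lambda$ on $\mathbb{R}$). Its product is given on basis elements by $$\mathbf{1}_m\mathbf{1}_n=\sum_{i=0}^{\min(m,n)}\lambda^i\binom{m+n-i}{m}\binom{m}{i}\mathbf{1}_{m+n-i}$$ and extended to infinite sums by distributivity (each $\mathbf{1}_u$ receives only finitely many contributions). The unit is $\mathbf{1}_0=1$. For $f:\mathbb{N}\to\mathbb{R}$, the $\lambda$-exponential generating function of $f$ is $E_{\lambda,f}=\sum_{k\ge 0}f(k)\mathbf{1}_k\in\widehat{\mathrm{Sh}}_\lambda(\mathbb{R})$. *)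

theory Defs
  imports Complex_Main "HOL-Algebra.Module" "HOL-Library.Infinite_Typeclass"
begin

text \<open>An element $\sum_k a_k \mathbf{1}_k$ of the complete algebra is encoded as its
  coefficient sequence \<open>a :: nat \<Rightarrow> real\<close>. The weight \<open>w\<close> enters only through the product.\<close>

definition sh_basis :: "nat \<Rightarrow> nat \<Rightarrow> real" where
  "sh_basis k = (\<lambda>u. if u = k then 1 else 0)"

definition sh_basis_mult :: "real \<Rightarrow> nat \<Rightarrow> nat \<Rightarrow> nat \<Rightarrow> real" where
  "sh_basis_mult w m n = (\<lambda>u. \<Sum>i = 0..min m n.
     w ^ i * real ((m + n - i) choose m) * real (m choose i) * sh_basis (m + n - i) u)"

text \<open>Since \<open>m + n - i \<ge> max m n\<close> for \<open>i \<le> min m n\<close>, only the pairs \<open>m, n \<le> u\<close> contribute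
  to the coefficient at \<open>u\<close> (lemma \<open>sh_basis_mult_eq_0\<close>), so the finite sum below is the full
  distributive extension to infinite sums.\<close>

definition sh_mult :: "real \<Rightarrow> (nat \<Rightarrow> real) \<Rightarrow> (nat \<Rightarrow> real) \<Rightarrow> nat \<Rightarrow> real" where
  "sh_mult w a b = (\<lambda>u. \<Sum>m\<le>u. \<Sum>n\<le>u. a m * b n * sh_basis_mult w m n u)"

lemma sh_basis_mult_eq_0: "u < m \<or> u < n \<Longrightarrow> sh_basis_mult w m n u = 0"
  unfolding sh_basis_mult_def sh_basis_def by (intro sum.neutral) auto

lemma sh_mult_basis: "sh_mult w (sh_basis m) (sh_basis n) = sh_basis_mult w m n"
proof
  fix u
  have "sh_mult w (sh_basis m) (sh_basis n) u
      = (\<Sum>m'\<le>u. if m' = m then (\<Sum>n'\<le>u. if n' = n then sh_basis_mult w m n u else 0) else 0)"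
    unfolding sh_mult_def
  proof (intro sum.cong refl)
    fix m'
    show "(\<Sum>n'\<le>u. sh_basis m m' * sh_basis n n' * sh_basis_mult w m' n' u)
        = (if m' = m then (\<Sum>n'\<le>u. if n' = n then sh_basis_mult w m n u else 0) else 0)"
      by (cases "m' = m") (auto simp only: sh_basis_def simp_thms if_True if_False mult_1
        mult_zero_left sum.neutral_const intro!: sum.cong split: if_split)
  qed
  then show "sh_mult w (sh_basis m) (sh_basis n) u = sh_basis_mult w m n u"
    by (auto simp: sh_basis_mult_eq_0)
qed

definition Sh :: "real \<Rightarrow> (real, nat \<Rightarrow> real) module" where
  "Sh w = \<lparr>carrier = UNIV, mult = sh_mult w, one = sh_basis 0,
     zero = (\<lambda>_. 0), add = (\<lambda>a b k. a k + b k), smult = (\<lambda>r a k. r * a k)\<rparr>"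

text \<open>With coefficient sequences as elements, $E_{\lambda,f}$ is the sequence \<open>f\<close> itself,
  regarded as an element of \<open>Sh w\<close>.\<close>

definition sh_egf :: "real \<Rightarrow> (nat \<Rightarrow> real) \<Rightarrow> nat \<Rightarrow> real" where
  "sh_egf w f = (\<lambda>k. f k)"

definition covers :: "nat \<Rightarrow> 'a set \<Rightarrow> (nat \<Rightarrow> 'a set) set" where
  "covers k T = {S \<in> {1..k} \<rightarrow>\<^sub>E Pow T. (\<Union>i\<in>{1..k}. S i) = T}"

definition eta :: "nat \<Rightarrow> (nat \<Rightarrow> 'a set) \<Rightarrow> int" where
  "eta k S = (\<Sum>I | I \<subseteq> {1..k} \<and> card I \<ge> 2. (-1) ^ card I * int (card (\<Inter>i\<in>I. S i)))"

text \<open>The exponents are integers, so no truncated subtraction occurs; they are in fact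
  nonnegative, and \<open>0 powi 0 = 1\<close>.\<close>

definition cover_sum_union :: "real \<Rightarrow> nat \<Rightarrow> (nat \<Rightarrow> nat \<Rightarrow> real) \<Rightarrow> 'a set \<Rightarrow> real" where
  "cover_sum_union w k f T = (\<Sum>S\<in>covers k T.
     w powi ((\<Sum>i=1..k. int (card (S i))) - int (card (\<Union>i\<in>{1..k}. S i)))
       * (\<Prod>i=1..k. f i (card (S i))))"

definition cover_sum_eta :: "real \<Rightarrow> nat \<Rightarrow> (nat \<Rightarrow> nat \<Rightarrow> real) \<Rightarrow> 'a set \<Rightarrow> real" where
  "cover_sum_eta w k f T = (\<Sum>S\<in>covers k T.
     w powi eta k S * (\<Prod>i=1..k. f i (card (S i))))"

text \<open>Both sums depend only on the cardinality of \<open>T\<close>, so they do define functions on \<open>nat\<close>.\<close>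

lemma covers_image:
  assumes "S \<in> covers k T"
  shows "(\<lambda>i\<in>{1..k}. g ` S i) \<in> covers k (g ` T)"
  using assms by (fastforce simp: covers_def PiE_iff)

lemma covers_image_inverse:
  assumes "S \<in> covers k T" and "\<And>x. x \<in> T \<Longrightarrow> g' (g x) = x"
  shows "(\<lambda>i\<in>{1..k}. g' ` ((\<lambda>i\<in>{1..k}. g ` S i) i)) = S"
proof
  fix i
  show "(\<lambda>i\<in>{1..k}. g' ` ((\<lambda>i\<in>{1..k}. g ` S i) i)) i = S i"
  proof (cases "i \<in> {1..k}")
    case True
    then have "S i \<subseteq> T" using assms(1) by (auto simp: covers_def PiE_iff)
    then have "g' ` g ` S i = S i" using assms(2) by (force simp: image_image)
    then show ?thesis using True by simp
  next
    case False
    then show ?thesis using assms(1) by (auto simp: covers_def PiE_def extensional_def)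
  qed
qed

lemma covers_sum_reindex:
  assumes g: "bij_betw g T U"
    and F: "\<And>S. S \<in> covers k T \<Longrightarrow> F S = G (\<lambda>i\<in>{1..k}. g ` S i)"
  shows "sum F (covers k T) = sum G (covers k U)"
proof -
  let ?g' = "the_inv_into T g"
  have U: "g ` T = U" and T: "?g' ` U = T"
    using g bij_betw_the_inv_into[OF g] by (auto simp: bij_betw_def)
  show ?thesis
  proof (rule sum.reindex_bij_witness[where i = "\<lambda>S. \<lambda>i\<in>{1..k}. ?g' ` S i"
        and j = "\<lambda>S. \<lambda>i\<in>{1..k}. g ` S i"])
    fix S assume S: "S \<in> covers k T"
    show "(\<lambda>i\<in>{1..k}. ?g' ` ((\<lambda>i\<in>{1..k}. g ` S i) i)) = S"
      by (rule covers_image_inverse[OF S]) (use g in \<open>auto simp: bij_betw_def the_inv_into_f_f\<close>)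
    show "(\<lambda>i\<in>{1..k}. g ` S i) \<in> covers k U" using covers_image[OF S, of g] U by simp
    show "G (\<lambda>i\<in>{1..k}. g ` S i) = F S" using F[OF S] by simp
  next
    fix S assume S: "S \<in> covers k U"
    show "(\<lambda>i\<in>{1..k}. g ` ((\<lambda>i\<in>{1..k}. ?g' ` S i) i)) = S"
      by (rule covers_image_inverse[OF S])
         (use g in \<open>auto simp: bij_betw_def intro: f_the_inv_into_f\<close>)
    show "(\<lambda>i\<in>{1..k}. ?g' ` S i) \<in> covers k T" using covers_image[OF S, of ?g'] T by simp
  qed
qed

lemma cover_sums_cong_bij:
  fixes T :: "'a set" and U :: "'b set"
  assumes g: "bij_betw g T U"
  shows "cover_sum_union w k f T = cover_sum_union w k f U"
    and "cover_sum_eta w k f T = cover_sum_eta w k f U"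
proof -
  have inj: "inj_on g T" and U: "g ` T = U" using g by (auto simp: bij_betw_def)
  have sub: "S i \<subseteq> T" if "S \<in> covers k T" "i \<in> {1..k}" for S i
    using that by (auto simp: covers_def PiE_iff)
  have card: "card (g ` S i) = card (S i)" if "S \<in> covers k T" "i \<in> {1..k}" for S i
    using sub[OF that] inj by (meson card_image inj_on_subset)
  have cardT: "card U = card T" using U card_image[OF inj] by simp
  have un: "(\<Union>i\<in>{1..k}. S i) = T" "(\<Union>i\<in>{1..k}. g ` S i) = U" if "S \<in> covers k T" for S
    using that U by (auto simp: covers_def)
  have eta: "eta k (\<lambda>i\<in>{1..k}. g ` S i) = eta k S" if S: "S \<in> covers k T" for S
    unfolding eta_def
  proof (intro sum.cong refl arg_cong2[where f = "(*)"] arg_cong[where f = int])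
    fix I assume "I \<in> {I. I \<subseteq> {1..k} \<and> 2 \<le> card I}"
    then have I: "I \<subseteq> {1..k}" "I \<noteq> {}" by auto
    then obtain j where j: "j \<in> I" by blast
    have "(\<Inter>i\<in>I. (\<lambda>i\<in>{1..k}. g ` S i) i) = (\<Inter>i\<in>I. g ` S i)" using I by auto
    also have "\<dots> = g ` (\<Inter>i\<in>I. S i)"
      using image_INT[OF inj, of I S j] sub[OF S] I j by blast
    finally have "(\<Inter>i\<in>I. (\<lambda>i\<in>{1..k}. g ` S i) i) = g ` (\<Inter>i\<in>I. S i)" .
    moreover have "(\<Inter>i\<in>I. S i) \<subseteq> T" using sub[OF S] I j by blast
    ultimately show "card (\<Inter>i\<in>I. (\<lambda>i\<in>{1..k}. g ` S i) i) = card (\<Inter>i\<in>I. S i)"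
      using inj by (metis card_image inj_on_subset)
  qed
  show "cover_sum_union w k f T = cover_sum_union w k f U"
    unfolding cover_sum_union_def
  proof (rule covers_sum_reindex[OF g], goal_cases)
    case (1 S)
    have "(\<Union>i\<in>{1..k}. (\<lambda>i\<in>{1..k}. g ` S i) i) = U" using un(2)[OF 1] by simp
    then show ?case by (simp only: un(1)[OF 1] cardT) (simp add: card[OF 1])
  qed
  show "cover_sum_eta w k f T = cover_sum_eta w k f U"
    unfolding cover_sum_eta_def
    by (rule covers_sum_reindex[OF g]) (simp only: eta, simp add: card)
qed

lemma cover_sums_well_defined:
  shows "\<exists>!h. \<forall>T :: 'a :: infinite set. finite T \<longrightarrow> h (card T) = cover_sum_union w k f T"
    and "\<exists>!h. \<forall>T :: 'a :: infinite set. finite T \<longrightarrow> h (card T) = cover_sum_eta w k f T"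
proof -
  have *: "\<exists>!h. \<forall>T :: 'a set. finite T \<longrightarrow> h (card T) = F T"
    if F: "\<And>T U g. bij_betw g T U \<Longrightarrow> F T = F U" for F :: "'a set \<Rightarrow> real"
  proof -
    have "\<exists>T :: 'a set. finite T \<and> card T = n" for n
      using infinite_arbitrarily_large[OF infinite_UNIV] by blast
    then obtain C :: "nat \<Rightarrow> 'a set" where C: "\<And>n. finite (C n)" "\<And>n. card (C n) = n"
      by metis
    show ?thesis
    proof (rule ex1I[of _ "\<lambda>n. F (C n)"])
      show "\<forall>T. finite T \<longrightarrow> F (C (card T)) = F T"
        using C F finite_same_card_bij by metis
      show "h = (\<lambda>n. F (C n))" if "\<forall>T. finite T \<longrightarrow> h (card T) = F T" for h
        using that C by (metis (no_types))
    qed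
  qed
  show "\<exists>!h. \<forall>T :: 'a set. finite T \<longrightarrow> h (card T) = cover_sum_union w k f T"
    by (rule *) (rule cover_sums_cong_bij)
  show "\<exists>!h. \<forall>T :: 'a set. finite T \<longrightarrow> h (card T) = cover_sum_eta w k f T"
    by (rule *) (rule cover_sums_cong_bij)
qed

end

theory Submission imports Defs begin

text \<open>Regard a sequence \<open>a\<close> as the set function \<open>T \<mapsto> a (card T)\<close>. The product of the basis
  elements counts the pairs \<open>(A, B)\<close> with \<open>A \<union> B = T\<close>, \<open>card A = m\<close>, \<open>card B = n\<close> and
  \<open>card (A \<inter> B) = i\<close>, so \<open>sh_mult\<close> is the convolution of set functions over pairs covering \<open>T\<close>,
  weighted by \<open>w ^ card (A \<inter> B)\<close>. Iterating this convolution gives the sum over \<open>k\<close>-tuples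
  covering \<open>T\<close>, since the exponents \<open>card A + card B - card (A \<union> B)\<close> telescope. The exponent
  \<open>eta\<close> is the same one by inclusion-exclusion.\<close>

section \<open>Convolution of set functions over covering pairs\<close>

definition union_conv :: "real \<Rightarrow> ('a set \<Rightarrow> real) \<Rightarrow> ('a set \<Rightarrow> real) \<Rightarrow> 'a set \<Rightarrow> real" where
  "union_conv w F G T = (\<Sum>(A, B) | A \<union> B = T. w ^ card (A \<inter> B) * F A * G B)"

lemma finite_union_pairs: "finite T \<Longrightarrow> finite {(A, B). A \<union> B = T}"
  by (rule finite_subset[of _ "Pow T \<times> Pow T"]) auto

lemma union_conv_cong:
  assumes "\<And>A. A \<subseteq> T \<Longrightarrow> F A = F' A" "\<And>A. A \<subseteq> T \<Longrightarrow> G A = G' A"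
  shows "union_conv w F G T = union_conv w F' G' T"
  unfolding union_conv_def using assms by (intro sum.cong) auto

lemma union_conv_commute: "union_conv w F G T = union_conv w G F T"
  unfolding union_conv_def
  by (rule sum.reindex_bij_witness[where i = prod.swap and j = prod.swap])
     (auto simp: Int_commute)

text \<open>Once \<open>A\<close> is fixed, a set \<open>B\<close> with
  \<open>A \<union> B = T\<close> must contain \<open>T - A\<close> and is determined by its overlap
  \<open>D = A \<inter> B\<close>, which can be any subset of \<open>A\<close>. Covering pairs thus
  become two successive choices of a subset, which binomials count.\<close>

lemma union_conv_nested:
  assumes "finite T"
  shows "union_conv w F G T = (\<Sum>A\<in>Pow T. \<Sum>D\<in>Pow A. w ^ card D * F A * G (T - A \<union> D))"
proof -
  have "(\<Sum>A\<in>Pow T. \<Sum>D\<in>Pow A. w ^ card D * F A * G (T - A \<union> D))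
      = (\<Sum>(A, D)\<in>Sigma (Pow T) Pow. w ^ card D * F A * G (T - A \<union> D))"
    using assms by (intro sum.Sigma) (auto intro: finite_subset)
  also have "\<dots> = union_conv w F G T"
    unfolding union_conv_def
  proof (rule sum.reindex_bij_witness[where i = "\<lambda>(A, B). (A, A \<inter> B)"
        and j = "\<lambda>(A, D). (A, T - A \<union> D)"], goal_cases)
    case (5 p)
    then obtain A D where p: "p = (A, D)" "A \<subseteq> T" "D \<subseteq> A" by auto
    then have "A \<inter> (T - A \<union> D) = D" by auto
    then show ?case by (simp add: p)
  qed auto
  finally show ?thesis by simp
qed

text \<open>Both sides run over the triples \<open>(A, B, C)\<close> with union \<open>T\<close>;
  the bracketing only decides whether \<open>A \<union> B\<close> or \<open>B \<union> C\<close> is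
  recorded as the intermediate set.\<close>

lemma union_conv_assoc:
  assumes "finite T"
  shows "union_conv w (union_conv w F G) H T = union_conv w F (union_conv w G H) T"
proof -
  let ?L = "Sigma {(X, C). X \<union> C = T} (\<lambda>(X, C). {(A, B). A \<union> B = X})"
  let ?R = "Sigma {(A, Y). A \<union> Y = T} (\<lambda>(A, Y). {(B, C). B \<union> C = Y})"
  have fin: "finite X" if "X \<subseteq> T" for X
    using that assms finite_subset by blast
  have "union_conv w (union_conv w F G) H T
      = (\<Sum>p | case p of (X, C) \<Rightarrow> X \<union> C = T. \<Sum>q\<in>(case p of (X, C) \<Rightarrow> {(A, B). A \<union> B = X}).
          w ^ card (fst p \<inter> snd p) * w ^ card (fst q \<inter> snd q) * F (fst q) * G (snd q) * H (snd p))"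
    unfolding union_conv_def
    by (intro sum.cong refl) (auto simp: sum_distrib_left sum_distrib_right mult_ac
          split_beta intro!: sum.cong)
  also have "\<dots> = (\<Sum>(p, q)\<in>?L.
      w ^ card (fst p \<inter> snd p) * w ^ card (fst q \<inter> snd q) * F (fst q) * G (snd q) * H (snd p))"
    by (intro sum.Sigma) (auto intro!: finite_union_pairs fin assms)
  also have "\<dots> = (\<Sum>(p, q)\<in>?R.
      w ^ card (fst p \<inter> snd p) * w ^ card (fst q \<inter> snd q) * F (fst p) * G (fst q) * H (snd q))"
  proof (rule sum.reindex_bij_witness[where j = "\<lambda>((X, C), (A, B)). ((A, B \<union> C), (B, C))"
        and i = "\<lambda>((A, Y), (B, C)). ((A \<union> B, C), (A, B))"], goal_cases)
    case (5 p)
    then obtain A B C where p: "p = ((A \<union> B, C), (A, B))" and T: "A \<union> B \<union> C = T" by auto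
    have [simp]: "finite A" "finite B" "finite C" using T by (auto intro!: fin)
    \<comment> \<open>both sides are \<open>card A + card B + card C - card T\<close>\<close>
    have "card ((A \<union> B) \<inter> C) + card (A \<inter> B) = card (A \<inter> (B \<union> C)) + card (B \<inter> C)"
      using card_Un_Int[of "A \<union> B" C] card_Un_Int[of A B] card_Un_Int[of A "B \<union> C"]
        card_Un_Int[of B C] by (simp add: Un_assoc)
    then show ?case by (simp add: p flip: power_add)
  qed auto
  also have "\<dots> = (\<Sum>p | case p of (A, Y) \<Rightarrow> A \<union> Y = T. \<Sum>q\<in>(case p of (A, Y) \<Rightarrow> {(B, C). B \<union> C = Y}).
          w ^ card (fst p \<inter> snd p) * w ^ card (fst q \<inter> snd q) * F (fst p) * G (fst q) * H (snd q))"
    by (intro sum.Sigma[symmetric]) (auto intro!: finite_union_pairs fin assms)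
  also have "\<dots> = union_conv w F (union_conv w G H) T"
    unfolding union_conv_def
    by (intro sum.cong refl) (auto simp: sum_distrib_left sum_distrib_right mult_ac
          split_beta intro!: sum.cong)
  finally show ?thesis .
qed

section \<open>Counting subsets: the product of sequences as a convolution\<close>

lemma sum_Pow_card:
  fixes g :: "nat \<Rightarrow> 'b::semiring_1"
  assumes "finite A"
  shows "(\<Sum>B\<in>Pow A. g (card B)) = (\<Sum>i\<le>card A. of_nat (card A choose i) * g i)"
proof -
  have "(\<Sum>B\<in>Pow A. g (card B)) = (\<Sum>i\<le>card A. \<Sum>B | B \<in> Pow A \<and> card B = i. g (card B))"
    using assms by (intro sum.group[symmetric]) (auto intro: card_mono)
  also have "\<dots> = (\<Sum>i\<le>card A. of_nat (card A choose i) * g i)"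
    using assms by (intro sum.cong refl) (simp add: n_subsets)
  finally show ?thesis .
qed

text \<open>At coefficient \<open>u\<close> only \<open>m + n - i = u\<close> survives, so
  \<open>n\<close> is eliminated in favour of \<open>i\<close>. The binomials left over count an
  \<open>m\<close>-subset of a \<open>u\<close>-set and an \<open>i\<close>-subset of that.\<close>

lemma sh_mult_nested:
  "sh_mult w a b u
    = (\<Sum>m\<le>u. real (u choose m) * (\<Sum>i\<le>m. real (m choose i) * (w ^ i * a m * b (u - m + i))))"
  unfolding sh_mult_def
proof (intro sum.cong refl)
  fix m assume "m \<in> {..u}"
  then have m: "m \<le> u" by simp
  let ?t = "\<lambda>n i. w ^ i * real ((m + n - i) choose m) * real (m choose i) * sh_basis (m + n - i) u"
  \<comment> \<open>The range of \<open>i\<close> may grow from \<open>min m n\<close> to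
    \<open>m\<close>: for \<open>n < i \<le> m\<close> the upper index \<open>m + n - i\<close> is
    below \<open>m\<close>, so the binomial vanishes.\<close>
  have "sh_basis_mult w m n u = (\<Sum>i\<le>m. ?t n i)" for n
    unfolding sh_basis_mult_def by (rule sum.mono_neutral_left) (auto simp: binomial_eq_0)
  then have "(\<Sum>n\<le>u. a m * b n * sh_basis_mult w m n u)
      = (\<Sum>i\<le>m. \<Sum>n\<le>u. a m * b n * ?t n i)"
    by (simp only: sum_distrib_left) (rule sum.swap)
  also have "\<dots> = (\<Sum>i\<le>m. \<Sum>n\<le>u. if n = u - m + i
      then a m * b (u - m + i) * (w ^ i * real (u choose m) * real (m choose i)) else 0)"
    using m by (intro sum.cong refl) (auto simp: sh_basis_def)
  also have "\<dots> = (\<Sum>i\<le>m. real (u choose m) * (real (m choose i) * (w ^ i * a m * b (u - m + i))))"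
    using m by (intro sum.cong refl) (auto simp: mult_ac)
  finally show "(\<Sum>n\<le>u. a m * b n * sh_basis_mult w m n u)
      = real (u choose m) * (\<Sum>i\<le>m. real (m choose i) * (w ^ i * a m * b (u - m + i)))"
    by (simp add: sum_distrib_left)
qed

text \<open>\<open>sum_Pow_card\<close> is applied twice to the nested form of the convolution, to
  the subsets \<open>D\<close> of \<open>A\<close> and then to the subsets \<open>A\<close> of
  \<open>T\<close>; this yields the nested form of the product.\<close>

lemma sh_mult_card:
  assumes "finite T"
  shows "sh_mult w a b (card T) = union_conv w (\<lambda>A. a (card A)) (\<lambda>B. b (card B)) T"
proof -
  let ?g = "\<lambda>m i. w ^ i * a m * b (card T - m + i)"
  have "union_conv w (\<lambda>A. a (card A)) (\<lambda>B. b (card B)) T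
      = (\<Sum>A\<in>Pow T. \<Sum>D\<in>Pow A. ?g (card A) (card D))"
    unfolding union_conv_nested[OF assms]
  proof (intro sum.cong refl)
    fix A D assume AD: "A \<in> Pow T" "D \<in> Pow A"
    then have "finite A" "finite D" using assms by (auto intro: finite_subset)
    then have "card (T - A \<union> D) = card T - card A + card D"
      using AD assms by (subst card_Un_disjoint) (auto simp: card_Diff_subset)
    then show "w ^ card D * a (card A) * b (card (T - A \<union> D)) = ?g (card A) (card D)" by simp
  qed
  also have "\<dots> = (\<Sum>A\<in>Pow T. \<Sum>i\<le>card A. real (card A choose i) * ?g (card A) i)"
    using assms by (intro sum.cong refl sum_Pow_card) (auto intro: finite_subset)
  also have "\<dots> = sh_mult w a b (card T)"
    unfolding sh_mult_nested
    using sum_Pow_card[OF assms, of "\<lambda>m. \<Sum>i\<le>m. real (m choose i) * ?g m i"] by simp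
  finally show ?thesis by simp
qed

lemma sh_mult_union_conv:
  "sh_mult w a b n = union_conv w (\<lambda>A. a (card A)) (\<lambda>B. b (card B)) {..<n}"
  using sh_mult_card[of "{..<n}"] by simp

section \<open>Commutative monoid laws\<close>

lemma sh_mult_commute: "sh_mult w a b = sh_mult w b a"
  by (rule ext) (simp add: sh_mult_union_conv union_conv_commute)

lemma sh_mult_assoc: "sh_mult w (sh_mult w a b) c = sh_mult w a (sh_mult w b c)"
proof
  fix n :: nat
  have fin: "finite A" if "A \<subseteq> {..<n}" for A
    using that finite_subset by blast
  have "sh_mult w (sh_mult w a b) c n = union_conv w
      (union_conv w (\<lambda>A. a (card A)) (\<lambda>B. b (card B))) (\<lambda>C. c (card C)) {..<n}"
    \<comment> \<open>Only the outer product is unfolded over \<open>{..<n}\<close>; the inner one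
      must become a convolution over each subset of it, which \<open>sh_mult_card\<close>
      provides.\<close>
    unfolding sh_mult_union_conv[of w "sh_mult w a b"]
    by (intro union_conv_cong) (simp_all add: sh_mult_card fin)
  also have "\<dots> = union_conv w (\<lambda>A. a (card A))
      (union_conv w (\<lambda>B. b (card B)) (\<lambda>C. c (card C))) {..<n}"
    by (simp add: union_conv_assoc)
  also have "\<dots> = sh_mult w a (sh_mult w b c) n"
    unfolding sh_mult_union_conv[of w a]
    by (intro union_conv_cong) (simp_all add: sh_mult_card fin)
  finally show "sh_mult w (sh_mult w a b) c n = sh_mult w a (sh_mult w b c) n" .
qed

lemma sh_mult_one: "sh_mult w (sh_basis 0) a = a"
proof
  fix n
  have "sh_mult w (sh_basis 0) a n = (\<Sum>m\<in>{0}. real (n choose m) *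
      (\<Sum>i\<le>m. real (m choose i) * (w ^ i * sh_basis 0 m * a (n - m + i))))"
    unfolding sh_mult_nested by (rule sum.mono_neutral_right) (auto simp: sh_basis_def)
  then show "sh_mult w (sh_basis 0) a n = a n" by (simp add: sh_basis_def)
qed

text \<open>Makes the rules for finite products available, in particular splitting off one
  factor.\<close>

lemma comm_monoid_Sh: "comm_monoid (Sh w)"
  by (rule comm_monoidI) (simp_all add: Sh_def sh_mult_assoc sh_mult_one, rule sh_mult_commute)

section \<open>Recursion for sums over covering tuples\<close>

lemma cover_sum_union_0:
  assumes "finite T"
  shows "cover_sum_union w 0 f T = sh_basis 0 (card T)"
proof -
  \<comment> \<open>The empty tuple is the function that is \<open>undefined\<close> everywhere. Its
    union is empty, so it covers only \<open>{}\<close>, which matches the unit.\<close>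
  have "covers 0 T = (if T = {} then {\<lambda>_. undefined} else {})"
    by (auto simp: covers_def)
  then show ?thesis
    using assms by (simp add: cover_sum_union_def sh_basis_def)
qed

text \<open>Splits off the last set of a tuple. Index \<open>Suc k\<close> is reset to
  \<open>undefined\<close> because members of \<open>covers k\<close> are extensional on
  \<open>{1..k}\<close>.\<close>

lemma covers_SucD:
  assumes "S \<in> covers (Suc k) T"
  shows "S(Suc k := undefined) \<in> covers k (\<Union>i\<in>{1..k}. S i)"
    and "(\<Union>i\<in>{1..k}. S i) \<union> S (Suc k) = T"
proof -
  have "{1..Suc k} = insert (Suc k) {1..k}" by auto
  with assms show "(\<Union>i\<in>{1..k}. S i) \<union> S (Suc k) = T" by (auto simp: covers_def)
  from assms show "S(Suc k := undefined) \<in> covers k (\<Union>i\<in>{1..k}. S i)"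
    by (auto simp: covers_def PiE_iff extensional_def)
qed

text \<open>The inverse of the splitting; since \<open>S (Suc k) = undefined\<close>, overwriting
  that index and resetting it gives back \<open>S\<close>.\<close>

lemma covers_SucI:
  assumes "S \<in> covers k A"
  shows "S(Suc k := B) \<in> covers (Suc k) (A \<union> B)"
    and "S (Suc k) = undefined"
    and "(\<Union>i\<in>{1..k}. S i) = A"
proof -
  have "{1..Suc k} = insert (Suc k) {1..k}" by auto
  with assms show "S(Suc k := B) \<in> covers (Suc k) (A \<union> B)"
    by (fastforce simp: covers_def PiE_iff extensional_def)
  from assms show "S (Suc k) = undefined" "(\<Union>i\<in>{1..k}. S i) = A"
    by (auto simp: covers_def PiE_iff extensional_def)
qed

lemma covers_subset: "S \<in> covers k T \<Longrightarrow> i \<in> {1..k} \<Longrightarrow> S i \<subseteq> T"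
  by (auto simp: covers_def PiE_iff)

lemma finite_covers: "finite T \<Longrightarrow> finite (covers k T)"
  by (rule finite_subset[of _ "{1..k} \<rightarrow>\<^sub>E Pow T"]) (auto simp: covers_def intro!: finite_PiE)

text \<open>With \<open>A\<close> the union of the first \<open>k\<close> sets and \<open>B\<close>
  the last set, the exponent grows by
  \<open>card A + card B - card (A \<union> B) = card (A \<inter> B)\<close>, the weight in the
  convolution.\<close>

lemma cover_sum_union_Suc:
  assumes "finite T"
  shows "cover_sum_union w (Suc k) f T
    = union_conv w (cover_sum_union w k f) (\<lambda>B. f (Suc k) (card B)) T"
proof -
  let ?e = "\<lambda>k S. (\<Sum>i=1..k. int (card (S i))) - int (card (\<Union>i\<in>{1..k}. S i :: 'a set))"
  let ?p = "\<lambda>k S. \<Prod>i=1..k. f i (card (S i :: 'a set))"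
  let ?R = "Sigma {(A, B). A \<union> B = T} (\<lambda>(A, B). covers k A)"
  have fin: "finite X" if "X \<subseteq> T" for X
    using that assms finite_subset by blast
  have "union_conv w (cover_sum_union w k f) (\<lambda>B. f (Suc k) (card B)) T
      = (\<Sum>p | case p of (A, B) \<Rightarrow> A \<union> B = T. \<Sum>S\<in>(case p of (A, B) \<Rightarrow> covers k A).
          w ^ card (fst p \<inter> snd p) * (w powi ?e k S * ?p k S) * f (Suc k) (card (snd p)))"
    unfolding union_conv_def cover_sum_union_def
    by (intro sum.cong refl) (auto simp: sum_distrib_left sum_distrib_right)
  also have "\<dots> = (\<Sum>(p, S)\<in>?R.
          w ^ card (fst p \<inter> snd p) * (w powi ?e k S * ?p k S) * f (Suc k) (card (snd p)))"
    by (intro sum.Sigma) (auto intro!: finite_union_pairs finite_covers fin assms)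
  also have "\<dots> = (\<Sum>S\<in>covers (Suc k) T. w powi ?e (Suc k) S * ?p (Suc k) S)"
  proof (rule sum.reindex_bij_witness[where j = "\<lambda>((A, B), S). S(Suc k := B)"
        and i = "\<lambda>S. ((\<Union>i\<in>{1..k}. S i, S (Suc k)), S(Suc k := undefined))"], goal_cases)
    case (1 p)
    then obtain A B S where p: "p = ((A, B), S)" and S: "S \<in> covers k A" by auto
    have "(\<Union>i\<in>{1..k}. (S(Suc k := B)) i) = (\<Union>i\<in>{1..k}. S i)" by auto
    then show ?case
      using covers_SucI(2,3)[OF S] by (simp add: p fun_upd_idem)
  next
    case (2 p)
    then show ?case using covers_SucI(1) by auto
  next
    case (3 S)
    then show ?case by simp
  next
    case (4 S)
    then show ?case using covers_SucD[OF 4] by simp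
  next
    case (5 p)
    then obtain A B S where p: "p = ((A, B), S)" and S: "S \<in> covers k A" and AB: "A \<union> B = T"
      by auto
    let ?S = "S(Suc k := B)"
    have fin_AB [simp]: "finite A" "finite B" using AB by (auto intro!: fin)
    have sums: "(\<Sum>i=1..k. int (card (?S i))) = (\<Sum>i=1..k. int (card (S i)))"
      "(\<Prod>i=1..k. f i (card (?S i))) = ?p k S"
      by (intro sum.cong prod.cong; simp)+
    have U: "(\<Union>i\<in>{1..k}. S i) = A" by (rule covers_SucI(3)[OF S])
    have U': "(\<Union>i\<in>{1..Suc k}. ?S i) = A \<union> B"
      using covers_SucI(1)[OF S, of B] by (simp add: covers_def)
    \<comment> \<open>For \<open>w = 0\<close> the law
      \<open>w powi (x + y) = w powi x * w powi y\<close> can fail at negative exponents, so the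
      exponent is first shown to be a natural number.\<close>
    have "card A \<le> (\<Sum>i=1..k. card (S i))"
      using card_UN_le[of "{1..k}" S] U by simp
    then have "?e k S \<ge> 0" unfolding U by (simp flip: of_nat_sum)
    then obtain d where d: "?e k S = int d" by (rule nonneg_int_cases)
    have "?e (Suc k) ?S = int (card (A \<inter> B)) + ?e k S"
      unfolding U U' using card_Un_Int[of A B] sums(1) by simp
    then have "w powi ?e (Suc k) ?S = w ^ card (A \<inter> B) * w powi ?e k S"
      unfolding d by (simp only: power_int_of_nat power_add flip: of_nat_add)
    then show ?case
      using sums(2) by (simp only: p prod.case fst_conv snd_conv) (simp add: mult_ac)
  qed
  finally show ?thesis by (simp only: cover_sum_union_def)
qed

section \<open>The exponent \<open>eta\<close> by inclusion-exclusion\<close>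

lemma eta_eq:
  assumes "\<And>i. i \<in> {1..k} \<Longrightarrow> finite (S i)"
  shows "eta k S = (\<Sum>i=1..k. int (card (S i))) - int (card (\<Union>i\<in>{1..k}. S i))"
proof -
  interpret Incl_Excl finite "\<lambda>A. int (card (A :: 'a set))"
    by standard (auto simp: card_Un_disjnt)
  \<comment> \<open>Inclusion-exclusion has sign \<open>(-1) ^ (card I + 1)\<close>, opposite to
    that in \<open>eta\<close>: singletons contribute the sum of the cardinalities and the larger
    index sets contribute \<open>- eta k S\<close>.\<close>
  let ?g = "\<lambda>I. (-1) ^ (card I + 1) * int (card (\<Inter>i\<in>I. S i))"
  have singletons: "{I. I \<subseteq> {1..k} \<and> card I = 1} = (\<lambda>i. {i}) ` {1..k}"
    by (auto simp: card_1_singleton_iff)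
  have split: "{I. I \<subseteq> {1..k} \<and> I \<noteq> {}}
      = {I. I \<subseteq> {1..k} \<and> card I = 1} \<union> {I. I \<subseteq> {1..k} \<and> card I \<ge> 2}"
  proof -
    have "I \<noteq> {} \<longleftrightarrow> card I = 1 \<or> card I \<ge> 2" if "I \<subseteq> {1..k}" for I
    proof -
      have "finite I" using that finite_subset by blast
      then have "I \<noteq> {} \<longleftrightarrow> card I \<noteq> 0" by simp
      then show ?thesis by linarith
    qed
    then show ?thesis by blast
  qed
  have "int (card (\<Union>i\<in>{1..k}. S i)) = (\<Sum>I | I \<subseteq> {1..k} \<and> I \<noteq> {}. ?g I)"
    using assms by (intro restricted_indexed) auto
  also have "\<dots> = (\<Sum>I | I \<subseteq> {1..k} \<and> card I = 1. ?g I) + (\<Sum>I | I \<subseteq> {1..k} \<and> card I \<ge> 2. ?g I)"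
    unfolding split by (rule sum.union_disjoint) auto
  also have "(\<Sum>I | I \<subseteq> {1..k} \<and> card I = 1. ?g I) = (\<Sum>i=1..k. int (card (S i)))"
    unfolding singletons by (subst sum.reindex) (auto simp: inj_on_def)
  also have "(\<Sum>I | I \<subseteq> {1..k} \<and> card I \<ge> 2. ?g I) = - eta k S"
    by (simp add: eta_def sum_negf)
  finally show ?thesis by simp
qed

lemma cover_sum_eta_eq_union:
  assumes "finite T"
  shows "cover_sum_eta w k f T = cover_sum_union w k f T"
  unfolding cover_sum_eta_def cover_sum_union_def
proof (intro sum.cong refl)
  fix S assume "S \<in> covers k T"
  then have "finite (S i)" if "i \<in> {1..k}" for i
    using covers_subset[OF _ that] assms finite_subset by metis
  then have "eta k S = (\<Sum>i=1..k. int (card (S i))) - int (card (\<Union>i\<in>{1..k}. S i))"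
    by (rule eta_eq)
  then show "w powi eta k S * (\<Prod>i=1..k. f i (card (S i)))
      = w powi ((\<Sum>i=1..k. int (card (S i))) - int (card (\<Union>i\<in>{1..k}. S i)))
        * (\<Prod>i=1..k. f i (card (S i)))"
    by simp
qed

section \<open>Covering sums as coefficients of finite products\<close>

lemma cover_sum_union_eq_finprod:
  assumes "finite T"
  shows "cover_sum_union w k f T = (\<Otimes>\<^bsub>Sh w\<^esub> i \<in> {1..k}. f i) (card T)"
  using assms
\<comment> \<open>\<open>T\<close> is generalized because the convolution evaluates the shorter sum
  at every subset of \<open>T\<close>.\<close>
proof (induction k arbitrary: T)
  case 0
  interpret comm_monoid "Sh w" by (rule comm_monoid_Sh)
  have "one (Sh w) = sh_basis 0" by (simp add: Sh_def)
  then show ?case using cover_sum_union_0[OF 0] by simp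
next
  case (Suc k)
  interpret comm_monoid "Sh w" by (rule comm_monoid_Sh)
  let ?P = "\<Otimes>\<^bsub>Sh w\<^esub> i \<in> {1..k}. f i"
  have UNIV: "carrier (Sh w) = UNIV" and mult: "mult (Sh w) = sh_mult w" by (simp_all add: Sh_def)
  have "{1..Suc k} = insert (Suc k) {1..k}" by auto
  then have "(\<Otimes>\<^bsub>Sh w\<^esub> i \<in> {1..Suc k}. f i) = sh_mult w (f (Suc k)) ?P"
    by (simp add: UNIV mult)
  \<comment> \<open>Splitting the product puts the new factor on the left, while the recursion
    appends the last set on the right.\<close>
  also have "\<dots> = sh_mult w ?P (f (Suc k))"
    by (rule sh_mult_commute)
  finally have "(\<Otimes>\<^bsub>Sh w\<^esub> i \<in> {1..Suc k}. f i) (card T)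
      = union_conv w (\<lambda>A. ?P (card A)) (\<lambda>B. f (Suc k) (card B)) T"
    by (simp add: sh_mult_card Suc.prems)
  also have "\<dots> = union_conv w (cover_sum_union w k f) (\<lambda>B. f (Suc k) (card B)) T"
  proof (intro union_conv_cong refl)
    fix A assume "A \<subseteq> T"
    then have "finite A" using Suc.prems finite_subset by blast
    then show "?P (card A) = cover_sum_union w k f A" by (rule Suc.IH[symmetric])
  qed
  finally show ?case using cover_sum_union_Suc[OF Suc.prems] by simp
qed

theorem theorem3p6:
  fixes w :: real and k :: nat and f :: "nat \<Rightarrow> nat \<Rightarrow> real" and h :: "nat \<Rightarrow> real"
  assumes "k \<ge> 2"
    and "(\<forall>T :: 'a :: infinite set. finite T \<longrightarrow> h (card T) = cover_sum_union w k f T)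
       \<or> (\<forall>T :: 'a set. finite T \<longrightarrow> h (card T) = cover_sum_eta w k f T)"
  shows "sh_egf w h = (\<Otimes>\<^bsub>Sh w\<^esub> i \<in> {1..k}. sh_egf w (f i))"
proof
  fix n
  \<comment> \<open>The type is infinite, so each \<open>n\<close> is the size of some finite set
    and \<open>h n\<close> is prescribed by the rule.\<close>
  obtain T :: "'a set" where T: "finite T" "card T = n"
    using infinite_arbitrarily_large[OF infinite_UNIV] by blast
  then have "h n = cover_sum_union w k f T"
    using assms(2) cover_sum_eta_eq_union by metis
  with T show "sh_egf w h n = (\<Otimes>\<^bsub>Sh w\<^esub> i \<in> {1..k}. sh_egf w (f i)) n"
    by (simp add: sh_egf_def cover_sum_union_eq_finprod)
qed

end
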